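(* For $n,k\ge 0$ let $a^{231}_{n,k}$ be the number of permutations $\sigma\in S_n$ that avoid the classical pattern $3\textrm{-}1\textrm{-}2$ and contain exactly $k$ occurrences of the consecutive pattern $231$, and let $A^{231}(t,z)=\sum_{n,k\ge 0}a^{231}_{n,k}t^nz^k$. Then $$A^{231}(t,z)=\frac{1-(1-z)t^2-\sqrt{((1-z)t^2+1)^2-4t}}{2t(1-(1-z)t)},$$ and for all $n\ge 1$, $k\ge 0$, $$a^{231}_{n,k}=\sum_{j=k}^{\lfloor (n-1)/2\rfloor}\frac{(-1)^{j-k}}{n-j}\binom{j}{k}\binom{n-j}{j}\binom{2n-3j}{n-j+1}.$$
   Context: A permutation $\sigma\in S_n$ avoids the classical pattern $3\textrm{-}1\textrm{-}2$ if there are no indices $i<j<l$ with $\sigma(j)<\sigma(l)<\sigma(i)$. An occurrence of the consecutive pattern $231$ in $\sigma\in S_n$ is an index $i$, $1\le i\le n-2$, with $\sigma(i+2)<\sigma(i)<\sigma(i+1)$. *)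

theory Defs
  imports
    "HOL-Computational_Algebra.Formal_Power_Series"
    "HOL-Combinatorics.Permutations"
begin

definition avoids_312 :: "nat \<Rightarrow> (nat \<Rightarrow> nat) \<Rightarrow> bool" where
  "avoids_312 n \<sigma> \<longleftrightarrow>
     \<not> (\<exists>i j l. 1 \<le> i \<and> i < j \<and> j < l \<and> l \<le> n \<and> \<sigma> j < \<sigma> l \<and> \<sigma> l < \<sigma> i)"

definition occurrences_231 :: "nat \<Rightarrow> (nat \<Rightarrow> nat) \<Rightarrow> nat set" where
  "occurrences_231 n \<sigma> =
     {i. 1 \<le> i \<and> i + 2 \<le> n \<and> \<sigma> (i + 2) < \<sigma> i \<and> \<sigma> i < \<sigma> (i + 1)}"

definition a231 :: "nat \<Rightarrow> nat \<Rightarrow> nat" where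
  "a231 n k =
     card {\<sigma>. \<sigma> permutes {1..n} \<and> avoids_312 n \<sigma> \<and> card (occurrences_231 n \<sigma>) = k}"

text \<open>
  Bivariate formal power series in t and z are series in t over the ring of series in z.
  The division of \<^typ>\<open>rat fps fps\<close> is the true quotient whenever it exists and the lowest
  nonzero t-coefficient of the denominator is invertible (here that coefficient is 2).
\<close>

definition var_t :: "rat fps fps" where
  "var_t = fps_X"

definition var_z :: "rat fps fps" where
  "var_z = fps_const fps_X"

definition A231 :: "rat fps fps" where
  "A231 = Abs_fps (\<lambda>n. Abs_fps (\<lambda>k. of_nat (a231 n k)))"

text \<open>
  The library's \<^const>\<open>fps_radical\<close> needs coefficients in a field, which series in z are not.
  The square root below is the branch with constant term 1; it exists and is unique
  for every radicand with constant term 1 as soon as 2 is invertible.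
\<close>

definition fps_sqrt :: "'a::comm_ring_1 fps \<Rightarrow> 'a fps" where
  "fps_sqrt f = (THE s. s ^ 2 = f \<and> fps_nth s 0 = 1)"

fun fps_sqrt_coeff :: "'a::comm_ring_1 \<Rightarrow> 'a fps \<Rightarrow> nat \<Rightarrow> 'a" where
  "fps_sqrt_coeff h f n =
     (if n = 0 then 1
      else h * (fps_nth f n - (\<Sum>i\<in>{1..<n}. fps_sqrt_coeff h f i * fps_sqrt_coeff h f (n - i))))"

declare fps_sqrt_coeff.simps [simp del]

lemma fps_sqrt_ex1:
  fixes f :: "'a::idom fps"
  assumes f0: "fps_nth f 0 = 1" and h: "2 * h = (1 :: 'a)"
  shows "\<exists>!s. s ^ 2 = f \<and> fps_nth s 0 = 1"
proof (rule ex_ex1I)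
  let ?c = "fps_sqrt_coeff h f"
  have "(Abs_fps ?c) ^ 2 = f"
  proof (rule fps_ext)
    fix n
    show "fps_nth ((Abs_fps ?c) ^ 2) n = fps_nth f n"
    proof (cases "n = 0")
      case True
      then show ?thesis using f0
        by (simp add: power2_eq_square fps_sqrt_coeff.simps[of h f 0])
    next
      case False
      let ?S = "\<Sum>i\<in>{1..<n}. ?c i * ?c (n - i)"
      have split: "{0..n} = insert 0 (insert n {1..<n})"
        using False by auto
      have "fps_nth ((Abs_fps ?c) ^ 2) n = (\<Sum>i=0..n. ?c i * ?c (n - i))"
        by (simp add: power2_eq_square fps_mult_nth)
      also have "\<dots> = 2 * ?c n + ?S"
        unfolding split using False by (simp add: fps_sqrt_coeff.simps[of h f 0])
      also have "2 * ?c n = (2 * h) * (fps_nth f n - ?S)"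
        by (subst fps_sqrt_coeff.simps) (simp add: False mult.assoc)
      finally show ?thesis by (simp add: h)
    qed
  qed
  then show "\<exists>s. s ^ 2 = f \<and> fps_nth s 0 = 1"
    by (intro exI[of _ "Abs_fps ?c"]) (simp add: fps_sqrt_coeff.simps[of h f 0])
next
  fix s r
  assume s: "s ^ 2 = f \<and> fps_nth s 0 = 1" and r: "r ^ 2 = f \<and> fps_nth r 0 = 1"
  have "s = r \<or> s = - r"
    using s r power2_eq_iff[of s r] by simp
  moreover have "s \<noteq> - r"
  proof
    assume "s = - r"
    then have "fps_nth s 0 = - fps_nth r 0" by simp
    then have "(1::'a) + 1 = 0" using s r by (simp add: eq_neg_iff_add_eq_0)
    then have "2 * h = 0" by simp
    with h show False by simp
  qed
  ultimately show "s = r" by blast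
qed

lemma fps_sqrt_rat:
  fixes f :: "rat fps fps"
  assumes "fps_nth f 0 = 1"
  shows "fps_sqrt f ^ 2 = f" and "fps_nth (fps_sqrt f) 0 = 1"
proof -
  have "2 * fps_const (1 / 2) = (1 :: rat fps)"
    by (simp add: numeral_fps_const)
  from theI'[OF fps_sqrt_ex1[OF assms this]]
  show "fps_sqrt f ^ 2 = f" and "fps_nth (fps_sqrt f) 0 = 1"
    unfolding fps_sqrt_def by auto
qed

end

theory Submission
  imports Defs
begin

text \<open>
  Let \<open>m\<close> be the last letter of a 312-avoiding permutation. All smaller letters precede all
  larger ones, so the word is \<open>S B m\<close> with \<open>S < m < B\<close> and both \<open>S\<close> and \<open>B\<close> 312-avoiding. The only
  occurrence of 231 outside \<open>S\<close> and \<open>B\<close> is formed by \<open>m\<close> and the last two letters of \<open>B\<close>, provided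
  these ascend; and a word ends with an ascent iff its last letter is its maximum and it has at
  least two letters. With \<open>u = z - 1\<close> this gives \<open>A = 1 + t A (A + u t (A - 1))\<close>, a quadratic equation
  whose solution is the closed form. For the coefficients put \<open>C = A - 1\<close>, so that
  \<open>C = t (1 + C) (1 + C + u t C)\<close>; Lagrange inversion, with \<open>v = u t\<close> treated as a parameter, yields
  \<open>k / m * (m choose j) * (2 m - j choose m + k)\<close> as the coefficient of \<open>t ^ m * v ^ j\<close> in \<open>C ^ k\<close>.
\<close>

section \<open>Permutations as reversed words\<close>

text \<open>
  Permutations are handled as words read from right to left, so that the last letter is the head
  of the list. This turns the patterns 312 and 231 into 213 and 132, and a final ascent into an
  initial descent.
\<close>

fun av213 :: "nat list \<Rightarrow> bool" where
  "av213 [] \<longleftrightarrow> True"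
| "av213 (x # xs) \<longleftrightarrow> sorted_wrt (\<lambda>p q. \<not> (p < x \<and> x < q)) xs \<and> av213 xs"

text \<open>Numeric, so that it can be added to \<open>occ132\<close>: a letter put in front of
  larger letters creates one more 132 exactly when these begin with a descent.\<close>

fun fst_desc :: "nat list \<Rightarrow> nat" where
  "fst_desc (x # y # xs) = (if y < x then 1 else 0)"
| "fst_desc _ = 0"

fun occ132 :: "nat list \<Rightarrow> nat" where
  "occ132 (x # y # w # xs) = (if x < w \<and> w < y then 1 else 0) + occ132 (y # w # xs)"
| "occ132 _ = 0"

definition rev_word :: "nat \<Rightarrow> (nat \<Rightarrow> nat) \<Rightarrow> nat list" where
  "rev_word n \<sigma> = map \<sigma> (rev [1..<Suc n])"

lemma rev_word_0 [simp]: "rev_word 0 \<sigma> = []"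
  by (simp add: rev_word_def)

lemma rev_word_Suc [simp]: "rev_word (Suc n) \<sigma> = \<sigma> (Suc n) # rev_word n \<sigma>"
  by (simp add: rev_word_def)

lemma set_rev_word: "set (rev_word n \<sigma>) = \<sigma> ` {1..n}"
  by (auto simp: rev_word_def)

lemma sorted_wrt_rev_word:
  "sorted_wrt P (rev_word n \<sigma>) \<longleftrightarrow> (\<forall>i j. 1 \<le> i \<and> i < j \<and> j \<le> n \<longrightarrow> P (\<sigma> j) (\<sigma> i))"
proof (induction n)
  case (Suc n)
  then show ?case
    by (auto simp: set_rev_word le_Suc_eq)
qed auto

lemma avoids_312_Suc:
  "avoids_312 (Suc n) \<sigma> \<longleftrightarrow> avoids_312 n \<sigma> \<and>
     (\<forall>i j. 1 \<le> i \<and> i < j \<and> j \<le> n \<longrightarrow> \<not> (\<sigma> j < \<sigma> (Suc n) \<and> \<sigma> (Suc n) < \<sigma> i))"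
  unfolding avoids_312_def by (auto simp: le_Suc_eq) (metis less_Suc_eq_le)+

lemma av213_rev_word: "av213 (rev_word n \<sigma>) \<longleftrightarrow> avoids_312 n \<sigma>"
proof (induction n)
  case 0
  then show ?case by (simp add: avoids_312_def)
next
  case (Suc n)
  then show ?case
    by (auto simp: avoids_312_Suc sorted_wrt_rev_word)
qed

lemma finite_occurrences_231: "finite (occurrences_231 n \<sigma>)"
  by (rule finite_subset[of _ "{..n}"]) (auto simp: occurrences_231_def)

lemma occ132_rev_word: "occ132 (rev_word n \<sigma>) = card (occurrences_231 n \<sigma>)"
proof (induction n)
  case 0
  then show ?case by (simp add: occurrences_231_def)
next
  case (Suc n)
  show ?case
  proof (cases "n \<ge> 2")
    case False
    then have "n = 0 \<or> n = 1" by auto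
    then show ?thesis by (auto simp: occurrences_231_def)
  next
    case True
    then obtain m where n: "n = Suc (Suc m)"
      by (metis add_2_eq_Suc le_Suc_ex)
    \<comment> \<open>Only the window ending at the last position \<open>Suc n\<close> is new; it
      starts at \<open>n - 1 = Suc m\<close>.\<close>
    have "occurrences_231 (Suc n) \<sigma> = occurrences_231 n \<sigma> \<union>
        (if \<sigma> (Suc n) < \<sigma> (Suc m) \<and> \<sigma> (Suc m) < \<sigma> n then {Suc m} else {})"
      by (auto simp: occurrences_231_def n le_Suc_eq)
    moreover have "Suc m \<notin> occurrences_231 n \<sigma>"
      by (simp add: occurrences_231_def n)
    ultimately show ?thesis
      using Suc by (simp add: n finite_occurrences_231)
  qed
qed

section \<open>Words over an interval and their bijection with permutations\<close>

text \<open>The least letter \<open>a\<close> is a parameter so that both blocks of a word are again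
  of this kind without being standardized.\<close>

definition av213_words :: "nat \<Rightarrow> nat \<Rightarrow> nat list set" where
  "av213_words a n = {xs. distinct xs \<and> set xs = {a..<a + n} \<and> av213 xs}"

lemma finite_av213_words: "finite (av213_words a n)"
  by (rule finite_subset[OF _ finite_subset_distinct[of "{a..<a + n}"]]) (auto simp: av213_words_def)

lemma av213_words_0 [simp]: "av213_words a 0 = {[]}"
  by (auto simp: av213_words_def)

lemma length_av213_words: "xs \<in> av213_words a n \<Longrightarrow> length xs = n"
  using distinct_card[of xs] by (auto simp: av213_words_def)

lemma bij_betw_rev_word:
  "bij_betw (rev_word n) {\<sigma>. \<sigma> permutes {1..n} \<and> avoids_312 n \<sigma>} (av213_words 1 n)"
proof (rule bij_betwI')
  fix \<sigma> \<tau>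
  assume "\<sigma> \<in> {\<sigma>. \<sigma> permutes {1..n} \<and> avoids_312 n \<sigma>}"
    "\<tau> \<in> {\<sigma>. \<sigma> permutes {1..n} \<and> avoids_312 n \<sigma>}"
  then have st: "\<sigma> permutes {1..n}" "\<tau> permutes {1..n}" by auto
  show "(rev_word n \<sigma> = rev_word n \<tau>) = (\<sigma> = \<tau>)"
  proof
    assume "rev_word n \<sigma> = rev_word n \<tau>"
    then have "\<forall>i\<in>{1..n}. \<sigma> i = \<tau> i"
      by (auto simp: rev_word_def)
    with st show "\<sigma> = \<tau>"
      by (metis ext permutes_not_in)
  qed simp
next
  fix \<sigma>
  assume "\<sigma> \<in> {\<sigma>. \<sigma> permutes {1..n} \<and> avoids_312 n \<sigma>}"
  then have s: "\<sigma> permutes {1..n}" "avoids_312 n \<sigma>" by auto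
  have "set (rev_word n \<sigma>) = {1..<1 + n}"
    using permutes_image[OF s(1)] by (auto simp: set_rev_word)
  moreover have "distinct (rev_word n \<sigma>)"
    unfolding rev_word_def distinct_map using permutes_inj_on[OF s(1)] by simp
  ultimately show "rev_word n \<sigma> \<in> av213_words 1 n"
    using s by (simp add: av213_words_def av213_rev_word)
next
  fix xs
  assume xs: "xs \<in> av213_words 1 n"
  then have len: "length xs = n" by (rule length_av213_words)
  \<comment> \<open>Reversal and zero-based indexing send position \<open>i\<close> to index
    \<open>n - i\<close>; outside \<open>{1..n}\<close> the identity is forced by
    \<open>permutes\<close>.\<close>
  define \<sigma> where "\<sigma> i = (if i \<in> {1..n} then xs ! (n - i) else i)" for i
  have w: "rev_word n \<sigma> = xs"
    by (rule nth_equalityI) (auto simp: rev_word_def len rev_nth \<sigma>_def simp del: upt_Suc)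
  have im: "\<sigma> ` {1..n} = {1..n}"
    using xs w set_rev_word[of n \<sigma>]
    by (simp add: av213_words_def atLeastLessThanSuc_atLeastAtMost)
  then have "bij_betw \<sigma> {1..n} {1..n}"
    by (simp add: bij_betw_def eq_card_imp_inj_on)
  then have "\<sigma> permutes {1..n}"
    by (rule bij_imp_permutes) (auto simp: \<sigma>_def)
  moreover have "avoids_312 n \<sigma>"
    using xs w av213_rev_word[of n \<sigma>] by (simp add: av213_words_def)
  ultimately show "\<exists>\<sigma>\<in>{\<sigma>. \<sigma> permutes {1..n} \<and> avoids_312 n \<sigma>}. xs = rev_word n \<sigma>"
    using w by blast
qed

lemma a231_eq_card_av213_words:
  "a231 n k = card {xs \<in> av213_words 1 n. occ132 xs = k}"
proof -
  have "bij_betw (rev_word n)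
      {\<sigma> \<in> {\<sigma>. \<sigma> permutes {1..n} \<and> avoids_312 n \<sigma>}. occ132 (rev_word n \<sigma>) = k}
      {xs \<in> av213_words 1 n. occ132 xs = k}"
    using bij_betw_rev_word[of n] unfolding bij_betw_def
    by (auto intro: inj_on_subset)
  from bij_betw_same_card[OF this] show ?thesis
    by (simp add: a231_def occ132_rev_word conj_assoc)
qed

section \<open>Decomposition at the first letter\<close>

text \<open>Once a letter below \<open>x\<close> has appeared, a later one above \<open>x\<close>
  would complete a 213 with \<open>x\<close> as the 2; so the large letters form a prefix.\<close>

lemma sorted_wrt_pivot_split:
  fixes x :: nat
  assumes "sorted_wrt (\<lambda>p q. \<not> (p < x \<and> x < q)) xs" "x \<notin> set xs"
  shows "\<exists>b s. xs = b @ s \<and> (\<forall>p\<in>set b. x < p) \<and> (\<forall>q\<in>set s. q < x)"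
  using assms
proof (induction xs)
  case (Cons y ys)
  show ?case
  proof (cases "y < x")
    case True
    then have "\<forall>q\<in>set (y # ys). q < x"
      using Cons.prems by (auto simp: not_less order.order_iff_strict)
    then show ?thesis by (intro exI[of _ "[]"] exI[of _ "y # ys"]) auto
  next
    case False
    from Cons obtain b s where "ys = b @ s" "\<forall>p\<in>set b. x < p" "\<forall>q\<in>set s. q < x"
      by auto
    with False Cons.prems show ?thesis
      by (intro exI[of _ "y # b"] exI[of _ s]) auto
  qed
qed simp

text \<open>In a 213 the last letter exceeds the first, so no occurrence starts in the high block
  \<open>b\<close> and ends in the low block \<open>s\<close>.\<close>

lemma av213_append:
  assumes "\<And>p q. p \<in> set b \<Longrightarrow> q \<in> set s \<Longrightarrow> q < p"
  shows "av213 (b @ s) \<longleftrightarrow> av213 b \<and> av213 s"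
  using assms
proof (induction b)
  case (Cons x b)
  have "sorted_wrt (\<lambda>p q. \<not> (p < x \<and> x < q)) s"
    by (rule sorted_wrt_mono_rel[of _ "\<lambda>_ _. True"])
       (use Cons.prems in \<open>auto simp: sorted_wrt_iff_nth_less dest: order.asym\<close>)
  moreover have "\<forall>p\<in>set b. \<forall>q\<in>set s. \<not> (p < x \<and> x < q)"
    using Cons.prems by (auto dest: order.asym)
  ultimately show ?case
    using Cons by (auto simp: sorted_wrt_append)
qed simp

lemma av213_pivot:
  assumes "\<forall>p\<in>set b. x < p" "\<forall>q\<in>set s. q < x"
  shows "av213 (x # b @ s) \<longleftrightarrow> av213 b \<and> av213 s"
proof -
  let ?P = "\<lambda>p q. \<not> (p < x \<and> x < q)"
  have "sorted_wrt ?P b" "sorted_wrt ?P s"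
    using assms by (auto simp: sorted_wrt_iff_nth_less dest: order.asym nth_mem)
  moreover have "\<forall>p\<in>set b. \<forall>q\<in>set s. ?P p q"
    using assms by (auto dest: order.asym)
  ultimately have "sorted_wrt ?P (b @ s)"
    by (simp add: sorted_wrt_append)
  moreover have "\<And>p q. p \<in> set b \<Longrightarrow> q \<in> set s \<Longrightarrow> q < p"
    using assms by (meson order.strict_trans)
  ultimately show ?thesis
    using av213_append[of b s] by simp
qed

text \<open>The last letter of a 132 exceeds its first, so no window across the border of
  \<open>b\<close> and \<open>s\<close> counts.\<close>

lemma occ132_append:
  assumes "\<And>p q. p \<in> set b \<Longrightarrow> q \<in> set s \<Longrightarrow> q < p"
  shows "occ132 (b @ s) = occ132 b + occ132 s"
  using assms
proof (induction b rule: occ132.induct)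
  case (1 x y w xs)
  then show ?case by simp
next
  case ("2_3" x y)
  then show ?case 
    by (cases s rule: occ132.cases) (auto dest: order.asym)
next
  case ("2_2" x)
  then show ?case
    by (cases s rule: occ132.cases) (auto dest: order.asym)
qed auto

text \<open>A window starting at \<open>x\<close> counts only if its other two letters exceed
  \<open>x\<close>; both then lie in \<open>b\<close> and form its initial descent.\<close>

lemma occ132_pivot:
  assumes "\<forall>p\<in>set b. x < p" "\<forall>q\<in>set s. q < x"
  shows "occ132 (x # b @ s) = occ132 s + (occ132 b + fst_desc b)"
proof -
  have "\<And>p q. p \<in> set b \<Longrightarrow> q \<in> set s \<Longrightarrow> q < p"
    using assms by (meson order.strict_trans)
  then have "occ132 (b @ s) = occ132 b + occ132 s"
    by (rule occ132_append)
  moreover have "occ132 (x # b @ s) = fst_desc b + occ132 (b @ s)"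
  proof (cases b rule: fst_desc.cases)
    case (1 y w v)
    then show ?thesis using assms by simp
  next
    case "2_1"
    then show ?thesis using assms by (cases s rule: fst_desc.cases) (auto dest: order.asym)
  next
    case ("2_2" v)
    then show ?thesis using assms by (cases s) (auto dest: order.asym)
  qed
  ultimately show ?thesis by simp
qed

lemma fst_desc_pivot:
  assumes "\<forall>p\<in>set b. x < p" "\<forall>q\<in>set s. q < x"
  shows "fst_desc (x # b @ s) = (if b = [] \<and> s \<noteq> [] then 1 else 0)"
  using assms by (cases b; cases s) (auto dest: order.asym)

text \<open>\<open>m\<close> is the number of letters below the first one; it fixes that letter and
  the letter sets of both blocks.\<close>

lemma av213_words_Suc:
  "av213_words a (Suc n) =
     (\<Union>m\<in>{..n}. (\<lambda>(s, b). (a + m) # b @ s) `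
       (av213_words a m \<times> av213_words (Suc (a + m)) (n - m)))"
proof (intro equalityI subsetI)
  fix ys
  assume ys: "ys \<in> av213_words a (Suc n)"
  then obtain x xs where x: "ys = x # xs"
    using length_av213_words by (metis length_Suc_conv)
  from ys x have "sorted_wrt (\<lambda>p q. \<not> (p < x \<and> x < q)) xs" "x \<notin> set xs"
    by (auto simp: av213_words_def)
  then obtain b s where bs: "xs = b @ s" "\<forall>p\<in>set b. x < p" "\<forall>q\<in>set s. q < x"
    using sorted_wrt_pivot_split by blast
  have all: "insert x (set b \<union> set s) = {a..<a + Suc n}"
    using ys by (auto simp: av213_words_def x bs(1))
  then have "x \<in> {a..<a + Suc n}" by blast
  then obtain m where m: "x = a + m" "m \<le> n"
    by (metis add_Suc_right atLeastLessThan_iff le_Suc_ex less_Suc_eq_le nat_add_left_cancel_le)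
  have "set s = {y \<in> {a..<a + Suc n}. y < x}" "set b = {y \<in> {a..<a + Suc n}. x < y}"
    unfolding all[symmetric] using bs by (auto dest: order.asym)
  moreover have "{y \<in> {a..<a + Suc n}. y < x} = {a..<a + m}"
    "{y \<in> {a..<a + Suc n}. x < y} = {Suc (a + m)..<Suc (a + m) + (n - m)}"
    using m by auto
  ultimately have "set s = {a..<a + m}" "set b = {Suc (a + m)..<Suc (a + m) + (n - m)}"
    by simp_all
  then have "s \<in> av213_words a m" "b \<in> av213_words (Suc (a + m)) (n - m)"
    using ys av213_pivot[OF bs(2,3)] by (auto simp: av213_words_def x bs(1))
  then show "ys \<in> (\<Union>m\<in>{..n}. (\<lambda>(s, b). (a + m) # b @ s) `
       (av213_words a m \<times> av213_words (Suc (a + m)) (n - m)))"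
    using m by (auto simp: x bs(1))
next
  fix ys
  assume "ys \<in> (\<Union>m\<in>{..n}. (\<lambda>(s, b). (a + m) # b @ s) `
       (av213_words a m \<times> av213_words (Suc (a + m)) (n - m)))"
  then obtain m s b where m: "m \<le> n" and ys: "ys = (a + m) # b @ s"
    and s: "s \<in> av213_words a m" and b: "b \<in> av213_words (Suc (a + m)) (n - m)"
    by auto
  have sets: "set s = {a..<a + m}" "set b = {Suc (a + m)..<Suc (a + n)}"
    using s b m by (auto simp: av213_words_def)
  then have "av213 ys"
    using av213_pivot[of b "a + m" s] s b by (auto simp: av213_words_def ys)
  moreover have "set ys = {a..<a + Suc n}" "distinct ys"
    using s b sets m by (auto simp: av213_words_def ys)
  ultimately show "ys \<in> av213_words a (Suc n)"
    by (simp add: av213_words_def)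
qed

section \<open>Generating polynomials and their recurrences\<close>

definition occ_gf :: "'a::comm_ring_1 \<Rightarrow> nat \<Rightarrow> nat \<Rightarrow> 'a" where
  "occ_gf z a n = (\<Sum>xs\<in>av213_words a n. z ^ occ132 xs)"

text \<open>The weight of the block \<open>b\<close>: \<open>fst_desc\<close> accounts for the
  occurrence formed with the letter in front of it.\<close>

definition occ_desc_gf :: "'a::comm_ring_1 \<Rightarrow> nat \<Rightarrow> nat \<Rightarrow> 'a" where
  "occ_desc_gf z a n = (\<Sum>xs\<in>av213_words a n. z ^ (occ132 xs + fst_desc xs))"

lemma sum_av213_words_Suc:
  fixes f :: "nat list \<Rightarrow> 'a::comm_ring_1"
  shows "(\<Sum>xs\<in>av213_words a (Suc n). f xs) =
    (\<Sum>m\<le>n. \<Sum>(s, b)\<in>av213_words a m \<times> av213_words (Suc (a + m)) (n - m). f ((a + m) # b @ s))"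
proof -
  let ?W = "\<lambda>m. av213_words a m \<times> av213_words (Suc (a + m)) (n - m)"
  let ?g = "\<lambda>m (s, b). (a + m) # b @ s"
  have "(\<Sum>xs\<in>av213_words a (Suc n). f xs) = (\<Sum>m\<le>n. \<Sum>xs\<in>?g m ` ?W m. f xs)"
    unfolding av213_words_Suc
    by (rule sum.UNION_disjoint) (auto simp: finite_av213_words)
  also have "\<dots> = (\<Sum>m\<le>n. \<Sum>p\<in>?W m. f (?g m p))"
  proof (intro sum.cong refl)
    fix m
    \<comment> \<open>The block lengths are fixed by \<open>m\<close> and \<open>n\<close>, so
      \<open>b @ s\<close> determines both blocks.\<close>
    have "inj_on (?g m) (?W m)"
      unfolding inj_on_def using length_av213_words by fastforce
    then show "(\<Sum>xs\<in>?g m ` ?W m. f xs) = (\<Sum>p\<in>?W m. f (?g m p))"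
      by (simp add: sum.reindex)
  qed
  finally show ?thesis by (simp add: case_prod_beta)
qed

lemma av213_words_pivot:
  assumes "s \<in> av213_words a m" "b \<in> av213_words (Suc (a + m)) l"
  shows "\<forall>p\<in>set b. a + m < p" "\<forall>q\<in>set s. q < a + m"
  using assms by (auto simp: av213_words_def)

lemma occ_gf_0 [simp]: "occ_gf z a 0 = 1" and occ_desc_gf_0 [simp]: "occ_desc_gf z a 0 = 1"
  by (simp_all add: occ_gf_def occ_desc_gf_def)

lemma occ_gf_Suc:
  "occ_gf z a (Suc n) = (\<Sum>m\<le>n. occ_gf z a m * occ_desc_gf z (Suc (a + m)) (n - m))"
proof -
  have "(\<Sum>(s, b)\<in>av213_words a m \<times> av213_words (Suc (a + m)) (n - m). z ^ occ132 ((a + m) # b @ s))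
      = occ_gf z a m * occ_desc_gf z (Suc (a + m)) (n - m)" for m
    unfolding occ_gf_def occ_desc_gf_def sum_product sum.cartesian_product
    by (intro sum.cong refl) (auto simp: occ132_pivot[OF av213_words_pivot] power_add)
  then show ?thesis
    unfolding occ_gf_def[of z a "Suc n"] sum_av213_words_Suc by simp
qed

text \<open>The two weights differ only on words with an initial descent, that is, a maximum
  followed by any nonempty avoiding word \<open>s\<close>. There the difference is
  \<open>(z - 1) * z ^ occ132 s\<close>. For \<open>n = 0\<close> the word is a single letter
  without descent.\<close>

lemma occ_desc_gf_Suc:
  "occ_desc_gf z a (Suc n) = occ_gf z a (Suc n) + (if n = 0 then 0 else (z - 1) * occ_gf z a n)"
proof -
  let ?d = "\<lambda>xs. z ^ (occ132 xs + fst_desc xs) - z ^ occ132 xs"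
  have "occ_desc_gf z a (Suc n) - occ_gf z a (Suc n) = (\<Sum>xs\<in>av213_words a (Suc n). ?d xs)"
    by (simp add: occ_desc_gf_def occ_gf_def sum_subtractf)
  also have "\<dots> = (\<Sum>m\<le>n. \<Sum>(s, b)\<in>av213_words a m \<times> av213_words (Suc (a + m)) (n - m).
        ?d ((a + m) # b @ s))"
    by (rule sum_av213_words_Suc)
  also have "\<dots> = (\<Sum>m\<le>n. if m = n then if n = 0 then 0 else (z - 1) * occ_gf z a n else 0)"
  proof (intro sum.cong refl)
    fix m assume m: "m \<in> {..n}"
    have d: "?d ((a + m) # b @ s) = (if m = n \<and> n \<noteq> 0 then (z - 1) * z ^ occ132 s else 0)"
      if sb: "s \<in> av213_words a m" "b \<in> av213_words (Suc (a + m)) (n - m)" for s b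
    proof -
      have "length s = m" "length b = n - m"
        using sb by (simp_all add: length_av213_words)
      then have "b = [] \<longleftrightarrow> m = n" "s = [] \<longleftrightarrow> m = 0"
        using m by auto
      then show ?thesis
        unfolding occ132_pivot[OF av213_words_pivot[OF sb]] fst_desc_pivot[OF av213_words_pivot[OF sb]]
        by (auto simp: algebra_simps)
    qed
    have "(\<Sum>(s, b)\<in>av213_words a m \<times> av213_words (Suc (a + m)) (n - m).
        ?d ((a + m) # b @ s))
      = (\<Sum>(s, b)\<in>av213_words a m \<times> av213_words (Suc (a + m)) (n - m).
           if m = n \<and> n \<noteq> 0 then (z - 1) * z ^ occ132 s else 0)"
      by (intro sum.cong refl) (clarsimp simp only: d mem_Times_iff fst_conv snd_conv)
    also have "\<dots> = (if m = n then if n = 0 then 0 else (z - 1) * occ_gf z a n else 0)"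
      by (auto simp: occ_gf_def sum_distrib_left sum.cartesian_product[symmetric])
    finally show "(\<Sum>(s, b)\<in>av213_words a m \<times> av213_words (Suc (a + m)) (n - m).
        ?d ((a + m) # b @ s))
      = (if m = n then if n = 0 then 0 else (z - 1) * occ_gf z a n else 0)" .
  qed
  finally show ?thesis by (simp add: algebra_simps)
qed

text \<open>The recurrences involve \<open>a\<close> only through the least letters of shorter
  words, so induction on the length suffices.\<close>

lemma occ_gf_shift: "occ_gf z a n = occ_gf z b n"
proof (induction n arbitrary: a b rule: less_induct)
  case (less n)
  show ?case
  proof (cases n)
    case (Suc k)
    have "occ_desc_gf z (Suc (a + m)) (k - m) = occ_desc_gf z (Suc (b + m)) (k - m)" for m
      using less[of "k - m" "Suc (a + m)" "Suc (b + m)"] less[of "k - m - 1" "Suc (a + m)" "Suc (b + m)"] Suc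
      by (cases "k - m") (auto simp: occ_desc_gf_Suc)
    moreover have "occ_gf z a m = occ_gf z b m" if "m \<le> k" for m
      using that Suc by (intro less) auto
    ultimately show ?thesis
      by (simp add: Suc occ_gf_Suc)
  qed simp
qed

section \<open>Functional equation for the bivariate series\<close>

lemma A231_nth: "fps_nth A231 n = occ_gf fps_X 1 n"
proof (rule fps_ext)
  fix k
  have "fps_nth (occ_gf fps_X 1 n) k = (\<Sum>xs\<in>av213_words 1 n. if occ132 xs = k then 1 else (0 :: rat))"
    by (auto simp: occ_gf_def fps_sum_nth fps_X_power_nth intro!: sum.cong)
  also have "\<dots> = of_nat (card {xs \<in> av213_words 1 n. occ132 xs = k})"
    by (simp add: sum.If_cases finite_av213_words Int_def)
  finally show "fps_nth (fps_nth A231 n) k = fps_nth (occ_gf fps_X 1 n) k"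
    by (simp add: A231_def a231_eq_card_av213_words)
qed

lemma var_z_minus_1: "var_z - 1 = (fps_const (fps_X - 1) :: rat fps fps)"
  by (simp add: var_z_def fps_const_sub[symmetric] del: fps_const_sub)

lemma A231_functional_equation:
  "A231 = 1 + var_t * (A231 * (A231 + (var_z - 1) * (var_t * (A231 - 1))))"
proof (rule fps_ext)
  fix n
  let ?E = "A231 + (var_z - 1) * (var_t * (A231 - 1))"
  \<comment> \<open>Wanted for every \<open>a\<close>, since the convolution uses the start
    \<open>Suc (1 + i)\<close>. Lengths 0 and 1 are separate cases because
    \<open>var_t * (A231 - 1)\<close> begins in degree 2.\<close>
  have E: "fps_nth ?E l = occ_desc_gf fps_X a l" for a l
    by (cases l; cases "l - 1")
       (auto simp: var_t_def var_z_minus_1 A231_nth occ_desc_gf_Suc occ_gf_shift[of _ "Suc 0" _ a])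
  show "fps_nth A231 n = fps_nth (1 + var_t * (A231 * ?E)) n"
  proof (cases n)
    case 0
    then show ?thesis by (simp add: A231_nth var_t_def)
  next
    case (Suc m)
    have "fps_nth A231 n = (\<Sum>i\<le>m. occ_gf fps_X 1 i * occ_desc_gf fps_X (Suc (1 + i)) (m - i))"
      by (simp add: A231_nth Suc occ_gf_Suc)
    also have "\<dots> = fps_nth (A231 * ?E) m"
      by (simp only: fps_mult_nth E[symmetric] A231_nth[symmetric] atMost_atLeast0)
    finally show ?thesis by (simp add: Suc var_t_def)
  qed
qed

section \<open>Ballot-type coefficients and their recurrence\<close>

text \<open>For \<open>j = 0\<close> and \<open>m > 0\<close> these are ballot numbers. The index
  \<open>m + k\<close> is the complement in \<open>2 * m - j\<close> of \<open>m - k - j\<close>,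
  the exponent extracted from \<open>(1 + w) ^ (2 * m - j)\<close> in Lagrange's formula. The clause
  for \<open>m = 0\<close> is the constant term of \<open>C ^ k\<close>.\<close>

definition ballot :: "nat \<Rightarrow> nat \<Rightarrow> nat \<Rightarrow> rat" where
  "ballot m k j = (if m = 0 then if k = 0 \<and> j = 0 then 1 else 0
     else of_nat k / of_nat m * of_nat (m choose j) * of_nat ((2 * m - j) choose (m + k)))"

lemma of_nat_binomial_absorb:
  "of_nat (Suc r) * of_nat (n choose Suc r) = (of_nat n - of_nat r) * (of_nat (n choose r) :: rat)"
proof (cases "r \<le> n")
  case True
  have "Suc r * (n choose Suc r) = (n - r) * (n choose r)"
    using binomial_absorb_comp[of n r] binomial_absorption[of r n] by simp
  then have "(of_nat (Suc r * (n choose Suc r)) :: rat) = of_nat ((n - r) * (n choose r))"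
    by (simp only:)
  with True show ?thesis by (simp add: of_nat_diff algebra_simps)
qed (simp add: binomial_eq_0)

text \<open>Coefficient form of \<open>C ^ (k + 1) = t * C ^ k * (1 + 2 * C + C ^ 2 + v * (C + C ^
  2))\<close>, the equation for \<open>C\<close> multiplied by \<open>C ^ k\<close>.\<close>

lemma ballot_Suc:
  "ballot (Suc m) (Suc k) j =
     ballot m k j + 2 * ballot m (Suc k) j + ballot m (Suc (Suc k)) j
     + (if j = 0 then 0 else ballot m (Suc k) (j - 1) + ballot m (Suc (Suc k)) (j - 1))"
proof (cases "m = 0")
  case True
  consider "j = 0" | "j = 1" | "j \<ge> 2" by linarith
  then show ?thesis
  proof cases
    case 1
    then show ?thesis using True by (cases k) (auto simp: ballot_def numeral_2_eq_2)
  next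
    case 3
    then show ?thesis using True by (auto simp: ballot_def)
  qed (use True in \<open>auto simp: ballot_def\<close>)
next
  case m: False
  show ?thesis
  proof (cases "j \<le> m")
    case True
    \<comment> \<open>Pascal's rule brings the second binomial of every term to upper index
      \<open>N\<close>, leaving the three adjacent ones \<open>X\<close>, \<open>Y\<close>,
      \<open>Z\<close>.\<close>
    define N where "N = 2 * m - j"
    define X Y Z where "X = (of_nat (N choose (m + k)) :: rat)"
      and "Y = (of_nat (N choose (m + Suc k)) :: rat)" and "Z = (of_nat (N choose (m + Suc (Suc k))) :: rat)"
    define B where "B = (of_nat (m choose j) :: rat)"
    define M K J where "M = (of_nat m :: rat)" and "K = (of_nat (Suc k) :: rat)" and "J = (of_nat j :: rat)"
    have N: "of_nat N = 2 * M - J" using True by (simp add: N_def M_def J_def of_nat_diff)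
    have Y: "(M + K) * Y = (M - J - K + 1) * X"
      using of_nat_binomial_absorb[of "m + k" N]
      unfolding N by (simp add: X_def Y_def M_def K_def algebra_simps)
    have Z: "(M + K + 1) * Z = (M - J - K) * Y"
      using of_nat_binomial_absorb[of "m + Suc k" N]
      unfolding N by (simp add: Z_def Y_def M_def K_def algebra_simps)
    have M: "M > 0" "M + 1 - J > 0" "M + 1 > 0"
      using m True by (simp_all add: M_def J_def)
    \<comment> \<open>The other binomials are rational multiples of \<open>B\<close>;
      \<open>j \<le> m\<close> keeps the denominator \<open>M + 1 - J\<close> positive.\<close>
    have B1: "(M + 1 - J) * of_nat (Suc m choose j) = (M + 1) * B"
    proof -
      have "(of_nat ((Suc m - j) * (Suc m choose j)) :: rat) = of_nat (Suc m * (m choose j))"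
        using binomial_absorb_comp[of "Suc m" j] by simp
      then show ?thesis
        unfolding of_nat_mult using True by (simp add: B_def M_def J_def of_nat_diff add.commute)
    qed
    have B2: "(M + 1 - J) * of_nat (m choose (j - 1)) = J * B" if "j > 0"
      using of_nat_binomial_absorb[of "j - 1" m] that
      by (simp add: B_def M_def J_def of_nat_diff algebra_simps)
    have N': "2 * Suc m - j = Suc (Suc N)" "2 * m - j = N" "j > 0 \<Longrightarrow> 2 * m - (j - 1) = Suc N"
      using True m by (auto simp: N_def)
    have Pascal: "of_nat (Suc (Suc N) choose (Suc m + Suc k)) = X + 2 * Y + Z"
        "of_nat (Suc N choose (m + Suc k)) = X + Y" "of_nat (Suc N choose (m + Suc (Suc k))) = Y + Z"
      by (simp_all add: X_def Y_def Z_def)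
    have KM: "of_nat k = K - 1" "of_nat (Suc (Suc k)) = K + 1" "of_nat (Suc m) = M + 1"
      by (simp_all add: K_def M_def)
    note defs = X_def[symmetric] Y_def[symmetric] Z_def[symmetric] B_def[symmetric]
      K_def[symmetric] M_def[symmetric]
    have l: "ballot (Suc m) (Suc k) j = K / (M + 1) * of_nat (Suc m choose j) * (X + 2 * Y + Z)"
      and r0: "ballot m k j = (K - 1) / M * B * X"
      and r1: "ballot m (Suc k) j = K / M * B * Y"
      and r2: "ballot m (Suc (Suc k)) j = (K + 1) / M * B * Z"
      and r3: "j > 0 \<Longrightarrow> ballot m (Suc k) (j - 1) = K / M * of_nat (m choose (j - 1)) * (X + Y)"
      and r4: "j > 0 \<Longrightarrow> ballot m (Suc (Suc k)) (j - 1) = (K + 1) / M * of_nat (m choose (j - 1)) * (Y + Z)"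
      by (simp_all only: ballot_def N' Pascal KM defs m if_False nat.distinct simp_thms)
    \<comment> \<open>What remains once the common factor \<open>B / (M * (M + 1 - J))\<close> is
      removed; it follows from the absorption relations \<open>Y\<close> and
      \<open>Z\<close>.\<close>
    have key: "K * M * (X + 2 * Y + Z) =
        (M + 1 - J) * ((K - 1) * X + 2 * K * Y + (K + 1) * Z) + J * (K * (X + Y) + (K + 1) * (Y + Z))"
      using Y Z by algebra
    have c: "of_nat (Suc m choose j) = (M + 1) * B / (M + 1 - J)"
      using B1 M by (simp add: field_simps)
    have shifted: "(if j = 0 then 0 else ballot m (Suc k) (j - 1) + ballot m (Suc (Suc k)) (j - 1))
        = J * B / (M * (M + 1 - J)) * (K * (X + Y) + (K + 1) * (Y + Z))"
    proof (cases "j = 0")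
      case False
      then have j: "j > 0" by simp
      define D where "D = (of_nat (m choose (j - 1)) :: rat)"
      have "ballot m (Suc k) (j - 1) + ballot m (Suc (Suc k)) (j - 1)
          = D / M * (K * (X + Y) + (K + 1) * (Y + Z))"
        unfolding r3[OF j] r4[OF j] D_def[symmetric]
        by (simp add: add_divide_distrib algebra_simps)
      moreover have "D = J * B / (M + 1 - J)"
        using B2[OF j] M by (simp add: D_def field_simps)
      ultimately show ?thesis using False by (simp add: mult.commute)
    qed (simp add: J_def)
    have "ballot m k j + 2 * ballot m (Suc k) j + ballot m (Suc (Suc k)) j
       + (if j = 0 then 0 else ballot m (Suc k) (j - 1) + ballot m (Suc (Suc k)) (j - 1))
       = B / (M * (M + 1 - J)) * ((M + 1 - J) * ((K - 1) * X + 2 * K * Y + (K + 1) * Z)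
           + J * (K * (X + Y) + (K + 1) * (Y + Z)))"
      unfolding shifted r0 r1 r2 using M by (simp add: divide_simps) (simp add: algebra_simps)
    also have "\<dots> = K / (M + 1) * of_nat (Suc m choose j) * (X + 2 * Y + Z)"
      unfolding key[symmetric] c using M by (simp add: divide_simps)
    finally show ?thesis using l by simp
  next
    \<comment> \<open>All terms vanish: at \<open>j = Suc m\<close> through the second binomial, for
      larger \<open>j\<close> through the first.\<close>
    case False
    then show ?thesis using m
      by (cases "j = Suc m") (auto simp: ballot_def binomial_eq_0)
  qed
qed

section \<open>Lagrange inversion\<close>

text \<open>The coefficient of \<open>t ^ n\<close> after substituting \<open>v = u * t\<close>: the
  monomial \<open>t ^ (n - j) * v ^ j\<close> contributes \<open>u ^ j\<close>.\<close>

definition ballot_gf :: "rat fps \<Rightarrow> nat \<Rightarrow> nat \<Rightarrow> rat fps" where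
  "ballot_gf u k n = (\<Sum>j\<le>n. fps_const (ballot (n - j) k j) * u ^ j)"

lemma ballot_gf_Suc:
  "ballot_gf u (Suc k) (Suc n) =
     ballot_gf u k n + 2 * ballot_gf u (Suc k) n + ballot_gf u (Suc (Suc k)) n
     + (if n = 0 then 0 else u * (ballot_gf u (Suc k) (n - 1) + ballot_gf u (Suc (Suc k)) (n - 1)))"
proof -
  let ?b = "\<lambda>m k j. fps_const (ballot m k j)"
  let ?R = "\<lambda>j. if j = 0 then 0 else (?b (n - j) (Suc k) (j - 1) + ?b (n - j) (Suc (Suc k)) (j - 1)) * u ^ j"
  \<comment> \<open>The summand \<open>j = Suc n\<close> drops out because
    \<open>ballot 0 (Suc k) (Suc n)\<close> is zero.\<close>
  have "ballot_gf u (Suc k) (Suc n) = (\<Sum>j\<le>n. ?b (Suc (n - j)) (Suc k) j * u ^ j)"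
    by (simp add: ballot_gf_def ballot_def Suc_diff_le)
  also have "\<dots> = (\<Sum>j\<le>n. ?b (n - j) k j * u ^ j + 2 * (?b (n - j) (Suc k) j * u ^ j)
      + ?b (n - j) (Suc (Suc k)) j * u ^ j + ?R j)"
    by (intro sum.cong refl)
       (simp add: ballot_Suc fps_const_add[symmetric] fps_const_mult[symmetric]
          numeral_fps_const[symmetric] distrib_right mult.assoc del: fps_const_add fps_const_mult)
  also have "\<dots> = ballot_gf u k n + 2 * ballot_gf u (Suc k) n + ballot_gf u (Suc (Suc k)) n
      + (\<Sum>j\<le>n. ?R j)"
    by (simp add: ballot_gf_def sum.distrib sum_distrib_left)
  also have "(\<Sum>j\<le>n. ?R j) =
      (if n = 0 then 0 else u * (ballot_gf u (Suc k) (n - 1) + ballot_gf u (Suc (Suc k)) (n - 1)))"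
  proof (cases n)
    case (Suc m)
    have "(\<Sum>j\<le>Suc m. ?R j) = (\<Sum>j\<le>m. ?R (Suc j))"
      by (subst sum.atMost_Suc_shift) simp
    then show ?thesis
      by (simp add: Suc ballot_gf_def sum.distrib[symmetric] sum_distrib_left algebra_simps
          del: fps_const_add)
  qed simp
  finally show ?thesis .
qed

text \<open>
  Lagrange inversion by uniqueness: multiplying the equation for \<open>C\<close> by \<open>C ^ k\<close> gives a linear
  recurrence that determines the coefficients of all powers of \<open>C\<close> at once, and \<^const>\<open>ballot_gf\<close>
  satisfies the same recurrence.
\<close>

lemma fps_power_nth_ballot_gf:
  fixes C :: "rat fps fps"
  assumes C: "C = fps_X * ((1 + C) * (1 + C + fps_const u * (fps_X * C)))"
  shows "fps_nth (C ^ k) n = ballot_gf u k n"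
proof (induction n arbitrary: k rule: less_induct)
  case (less n)
  have C0: "fps_nth C 0 = 0"
    by (subst C) simp
  show ?case
  proof (cases n)
    case 0
    then show ?thesis
      by (simp add: fps_power_zeroth C0 ballot_gf_def ballot_def power_0_left)
  next
    case n: (Suc m)
    show ?thesis
    proof (cases k)
      case 0
      have "ballot (n - j) 0 j = 0" for j
        using n by (simp add: ballot_def)
      then show ?thesis by (simp add: 0 n ballot_gf_def)
    next
      case k: (Suc l)
      \<comment> \<open>Expanding one factor \<open>C\<close> produces higher powers, but only at
        smaller coefficient indices; hence the induction on \<open>n\<close> with \<open>k\<close>
        arbitrary.\<close>
      have "C ^ k = C ^ l * (fps_X * ((1 + C) * (1 + C + fps_const u * (fps_X * C))))"
        using C by (simp add: k mult.commute)
      also have "\<dots> = fps_X * (C ^ l + 2 * C ^ Suc l + C ^ Suc (Suc l)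
          + fps_const u * (fps_X * (C ^ Suc l + C ^ Suc (Suc l))))"
        by (simp add: algebra_simps)
      finally have "fps_nth (C ^ k) n =
          fps_nth (C ^ l) m + 2 * fps_nth (C ^ Suc l) m + fps_nth (C ^ Suc (Suc l)) m
          + u * (if m = 0 then 0 else fps_nth (C ^ Suc l) (m - 1) + fps_nth (C ^ Suc (Suc l)) (m - 1))"
        by (simp add: n numeral_fps_const)
      also have "\<dots> = ballot_gf u k n"
        using n by (simp only: less lessI less_imp_diff_less k ballot_gf_Suc) simp
      finally show ?thesis .
    qed
  qed
qed

section \<open>Closed form and coefficient extraction\<close>

lemma fps_X_minus_1_power_nth:
  "fps_nth ((fps_X - 1) ^ j) k = (if k \<le> j then (-1) ^ (j - k) * of_nat (j choose k) else (0 :: rat))"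
proof -
  have "(fps_X - 1 :: rat fps) ^ j = (\<Sum>i\<le>j. of_nat (j choose i) * fps_X ^ i * (-1) ^ (j - i))"
    using binomial_ring[of fps_X "-1 :: rat fps" j] by simp
  also have "\<dots> = (\<Sum>i\<le>j. fps_const ((-1) ^ (j - i) * of_nat (j choose i)) * fps_X ^ i)"
    by (intro sum.cong refl)
       (simp add: fps_const_mult[symmetric] fps_const_power[symmetric] fps_of_nat fps_const_neg[symmetric] mult_ac
         del: fps_const_mult fps_const_power fps_const_neg)
  finally show ?thesis
    by (simp add: fps_sum_nth fps_X_power_nth if_distrib cong: if_cong)
qed

lemma A231_quadratic:
  "var_t * (1 - (1 - var_z) * var_t) * A231 ^ 2 - (1 - (1 - var_z) * var_t ^ 2) * A231 + 1 = 0"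
  using A231_functional_equation by algebra

text \<open>Completing the square in \<open>A231_quadratic\<close>: \<open>?s\<close> squares to the
  discriminant, and its constant term 1 selects the branch.\<close>

lemma A231_closed_form:
  "A231 =
      (1 - (1 - var_z) * var_t ^ 2 - fps_sqrt (((1 - var_z) * var_t ^ 2 + 1) ^ 2 - 4 * var_t))
        / (2 * var_t * (1 - (1 - var_z) * var_t))"
proof -
  define D where "D = 2 * (1 - (1 - var_z) * var_t)"
  let ?f = "((1 - var_z) * var_t ^ 2 + 1) ^ 2 - 4 * var_t"
  let ?s = "1 - (1 - var_z) * var_t ^ 2 - var_t * D * A231"
  have half: "2 * fps_const (1 / 2) = (1 :: rat fps)"
    by (simp add: numeral_fps_const)
  have "?s ^ 2 = ?f"
    unfolding D_def using A231_quadratic by algebra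
  moreover have "fps_nth ?s 0 = 1"
    by (simp add: var_t_def power2_eq_square)
  moreover have "fps_nth ?f 0 = 1"
    by (simp add: var_t_def power2_eq_square)
  ultimately have s: "fps_sqrt ?f = ?s"
    unfolding fps_sqrt_def using fps_sqrt_ex1[OF _ half, of ?f] by (intro the1_equality) auto
  have D0: "fps_nth D 0 = 2"
    by (simp add: D_def var_t_def)
  have den: "2 * var_t * (1 - (1 - var_z) * var_t) = var_t * D"
    by (simp add: D_def)
  have sub: "subdegree (var_t * D) = 1"
    by (rule subdegreeI) (auto simp: var_t_def D0)
  have uf: "unit_factor (var_t * D) = D"
    unfolding fps_unit_factor_def sub by (rule fps_ext) (simp add: var_t_def)
  \<comment> \<open>The constant coefficient 2 of \<open>D\<close> is a unit of the series in z,
    which makes \<open>D\<close> invertible.\<close>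
  have "inverse (2 :: rat fps) * 2 = 1"
    by (rule inverse_mult_eq_1) simp
  then have "D * inverse D = 1"
    using fps_right_inverse[of D "inverse 2"] by (simp add: fps_inverse_def D0 mult.commute)
  then have "var_t * D * A231 * inverse D = fps_X * A231"
    by (simp add: var_t_def mult_ac)
  \<comment> \<open>Division multiplies by the inverse of the unit factor \<open>D\<close> and
    shifts by the subdegree 1, which cancels \<open>fps_X\<close>.\<close>
  then have "var_t * D * A231 / (var_t * D) = A231"
    unfolding fps_divide_def sub uf by (simp add: fps_eq_iff)
  then show ?thesis
    unfolding s den by simp
qed

text \<open>The first power of \<open>A231 - 1\<close> is read off from \<open>ballot_gf\<close> at
  \<open>u = z - 1\<close>; expanding \<open>(z - 1) ^ j\<close> produces the signs.\<close>

lemma a231_formula: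
  assumes "n \<ge> 1"
  shows "(of_nat (a231 n k) :: rat) =
        (\<Sum>j = k..(n - 1) div 2.
          (-1) ^ (j - k) / of_nat (n - j)
            * of_nat (j choose k) * of_nat ((n - j) choose j)
            * of_nat ((2 * n - 3 * j) choose (n - j + 1)))"
proof -
  let ?C = "A231 - 1"
  let ?term = "\<lambda>j. (-1) ^ (j - k) / of_nat (n - j) * of_nat (j choose k) * of_nat ((n - j) choose j)
            * of_nat ((2 * n - 3 * j) choose (n - j + 1)) :: rat"
  have "?C = fps_X * ((1 + ?C) * (1 + ?C + fps_const (fps_X - 1) * (fps_X * ?C)))"
    using A231_functional_equation by (simp add: var_t_def var_z_minus_1 algebra_simps)
  from fps_power_nth_ballot_gf[OF this, of 1 n]
  have "fps_nth A231 n = ballot_gf (fps_X - 1) 1 n"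
    using assms by simp
  then have "of_nat (a231 n k) = fps_nth (ballot_gf (fps_X - 1) 1 n) k"
    by (simp add: A231_def fps_eq_iff)
  also have "\<dots> = (\<Sum>j\<le>n. ballot (n - j) 1 j * (if k \<le> j then (-1) ^ (j - k) * of_nat (j choose k) else 0))"
    by (simp add: ballot_gf_def fps_sum_nth fps_X_minus_1_power_nth)
  also have "\<dots> = (\<Sum>j = k..(n - 1) div 2. ballot (n - j) 1 j * ((-1) ^ (j - k) * of_nat (j choose k)))"
  \<comment> \<open>For \<open>2 * j \<ge> n\<close> with \<open>j < n\<close> the lower index
    \<open>n - j + 1\<close> exceeds the upper one; at \<open>j = n\<close> the clause of
    \<open>ballot\<close> for \<open>m = 0\<close> gives zero.\<close>
  proof (rule sum.mono_neutral_cong_right)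
    show "{k..(n - 1) div 2} \<subseteq> {..n}" by auto
    show "\<forall>j\<in>{..n} - {k..(n - 1) div 2}.
        ballot (n - j) 1 j * (if k \<le> j then (-1) ^ (j - k) * of_nat (j choose k) else 0) = 0"
      by (auto simp: ballot_def binomial_eq_0)
  qed auto
  also have "\<dots> = (\<Sum>j = k..(n - 1) div 2. ?term j)"
  proof (intro sum.cong refl)
    fix j assume "j \<in> {k..(n - 1) div 2}"
    then have "n - j \<noteq> 0" "2 * (n - j) - j = 2 * n - 3 * j"
      using assms by auto
    then show "ballot (n - j) 1 j * ((-1) ^ (j - k) * of_nat (j choose k)) = ?term j"
      by (simp add: ballot_def)
  qed
  finally show ?thesis .
qed

theorem theorem5:
  shows "(A231 =
      (1 - (1 - var_z) * var_t ^ 2 - fps_sqrt (((1 - var_z) * var_t ^ 2 + 1) ^ 2 - 4 * var_t))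
        / (2 * var_t * (1 - (1 - var_z) * var_t)))
    \<and> (\<forall>n k. n \<ge> 1 \<longrightarrow>
      (of_nat (a231 n k) :: rat) =
        (\<Sum>j = k..(n - 1) div 2.
          (-1) ^ (j - k) / of_nat (n - j)
            * of_nat (j choose k) * of_nat ((n - j) choose j)
            * of_nat ((2 * n - 3 * j) choose (n - j + 1))))"
  using A231_closed_form a231_formula by blast

end
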